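(* Let $b>1$ be an integer and let $\alpha\neq\beta$ be two distinct digits in $\{0,\dots,b-1\}$. Let $K_0$ be the sum of the reciprocals $1/n$ over all integers $n>0$ whose base-$b$ representation has no occurrence of the two-digit string $\alpha\beta$. Then $$ \begin{aligned} K_0 ={}& \sum_{n_1=1}^{b-1}\frac1{n_1} + b^2\Bigl(\sum_{\substack{1\leq n_1<b\\0\leq n_2<b\\(n_1,n_2)\neq(\alpha,\beta)}} \frac1{n_1b+n_2} -\sum_{1\leq n_1<b}\frac1{n_1b^2+\alpha b + \beta}\Bigr)\\ &+ \sum_{m=1}^\infty (-1)^m u_m\Bigl( \sum_{\substack{1\leq n_1<b\\0\leq n_2<b\\(n_1,n_2)\neq(\alpha,\beta)}} \frac1{(n_1 b + n_2)^{m+1}} -\sum_{1\leq n_1<b}\frac1{(n_1 b^2 + \alpha b + \beta)^{m+1}}\Bigr), \end{aligned} $$ where the sequence $(u_m)_{m\ge0}$ obeys $u_0=b^2$ and, for all $m\geq1$, $$ (b^{m+1} - b + b^{-m-1})\, u_m = \sum_{j=1}^{m}\binom{m}{j} \Bigl(\gamma_j - b^{-m-1}(\alpha b + \beta)^j\Bigr) u_{m-j}, \qquad \gamma_j=\sum_{0\le d<b} d^j . $$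
   Context: The base-$b$ representation of a positive integer is its minimal one (no leading zeroes). An occurrence of $\alpha\beta$ means that the digits $\alpha,\beta$ appear at two consecutive positions, in this order (most significant first). *)

theory Defs
  imports "HOL-Analysis.Analysis" "HOL-Library.Sublist"
begin

text \<open>
  Digits in base \<open>b\<close>, most significant first. The number 0 has the empty digit list, so that no
  leading zero is ever produced. The degenerate bases \<open>b \<le> 1\<close> are only there for totality.
\<close>

fun base_digits :: "nat \<Rightarrow> nat \<Rightarrow> nat list" where
  "base_digits b n =
     (if b \<le> 1 \<or> n = 0 then [] else base_digits b (n div b) @ [n mod b])"

declare base_digits.simps [simp del]

lemma base_digits_0 [simp]: "base_digits b 0 = []"
  by (simp add: base_digits.simps)

lemma base_digits_rec:
  assumes "b > 1" "n > 0"
  shows "base_digits b n = base_digits b (n div b) @ [n mod b]"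
  using assms by (subst base_digits.simps) simp

lemma base_digits_eq_Nil_iff: "b > 1 \<Longrightarrow> base_digits b n = [] \<longleftrightarrow> n = 0"
  by (cases "n = 0") (auto simp: base_digits_rec)

lemma set_base_digits: "b > 1 \<Longrightarrow> set (base_digits b n) \<subseteq> {..<b}"
proof (induction n rule: less_induct)
  case (less n)
  show ?case
  proof (cases "n = 0")
    case False
    then have "n div b < n" using less.prems by simp
    from less.IH[OF this less.prems] False less.prems show ?thesis
      by (auto simp: base_digits_rec)
  qed simp
qed

lemma hd_base_digits: "b > 1 \<Longrightarrow> n > 0 \<Longrightarrow> hd (base_digits b n) \<noteq> 0"
proof (induction n rule: less_induct)
  case (less n)
  show ?case
  proof (cases "n div b = 0")
    case True
    then show ?thesis
      using less.prems by (simp add: base_digits_rec div_eq_0_iff)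
  next
    case False
    moreover have "n div b < n" using less.prems by simp
    ultimately show ?thesis
      using less.IH[of "n div b"] less.prems
      by (simp add: base_digits_rec[of b n] base_digits_eq_Nil_iff)
  qed
qed

lemma horner_sum_base_digits: "b > 1 \<Longrightarrow> horner_sum id b (rev (base_digits b n)) = n"
proof (induction n rule: less_induct)
  case (less n)
  show ?case
  proof (cases "n = 0")
    case False
    then have "n div b < n" using less.prems by simp
    from less.IH[OF this less.prems] False less.prems show ?thesis
      by (simp add: base_digits_rec)
  qed simp
qed

lemma base_digits_unique:
  assumes "b > 1" "set ds \<subseteq> {..<b}" "ds \<noteq> [] \<Longrightarrow> hd ds \<noteq> 0"
  shows "base_digits b (horner_sum id b (rev ds)) = ds"
  using assms(2,3)
proof (induction ds rule: rev_induct)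
  case (snoc d ds)
  have IH: "base_digits b (horner_sum id b (rev ds)) = ds"
    using snoc.prems by (intro snoc.IH) (auto simp: hd_append split: if_splits)
  have d: "d < b" using snoc.prems by simp
  have pos: "d + b * horner_sum id b (rev ds) > 0"
  proof (cases "ds = []")
    case True
    then show ?thesis using snoc.prems by simp
  next
    case False
    then have "horner_sum id b (rev ds) \<noteq> 0" using IH by (metis base_digits_0)
    then show ?thesis using assms(1) by (metis add_is_0 mult_is_0 neq0_conv not_less_zero)
  qed
  show ?case
    using base_digits_rec[OF assms(1) pos] d IH assms(1) by (simp add: id_def)
qed simp

text \<open>
  Here \<^const>\<open>sublist\<close> means a contiguous infix (in contrast to \<^const>\<open>subseq\<close>).
\<close>

definition avoiding :: "nat \<Rightarrow> nat \<Rightarrow> nat \<Rightarrow> nat set" where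
  "avoiding b \<alpha> \<beta> = {n. n > 0 \<and> \<not> sublist [\<alpha>, \<beta>] (base_digits b n)}"

definition kempner_sum :: "nat \<Rightarrow> nat \<Rightarrow> nat \<Rightarrow> real" where
  "kempner_sum b \<alpha> \<beta> = (\<Sum>\<^sub>\<infinity>n\<in>avoiding b \<alpha> \<beta>. 1 / real n)"

definition digit_power_sum :: "nat \<Rightarrow> nat \<Rightarrow> real" where
  "digit_power_sum b j = (\<Sum>d<b. real d ^ j)"

text \<open>
  The common shape of the bracketed expressions, with general exponent \<open>k\<close>
  (namely \<open>k = 1\<close> for the initial term and \<open>k = m + 1\<close> in the series).
\<close>

definition inverse_power_diff :: "nat \<Rightarrow> nat \<Rightarrow> nat \<Rightarrow> nat \<Rightarrow> real" where
  "inverse_power_diff b \<alpha> \<beta> k =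
     (\<Sum>(n\<^sub>1, n\<^sub>2) \<in> {1..<b} \<times> {0..<b} - {(\<alpha>, \<beta>)}. 1 / real (n\<^sub>1 * b + n\<^sub>2) ^ k)
     - (\<Sum>n\<^sub>1 = 1..<b. 1 / real (n\<^sub>1 * b^2 + \<alpha> * b + \<beta>) ^ k)"

end

theory Submission
  imports Defs
begin

text \<open>
  Call a word of digits admissible if it has no factor \<open>\<alpha>\<beta>\<close>, leading zeros and the empty word being
  allowed. Give a word \<open>X\<close> of length \<open>l\<close> the weight \<open>b^(-l)\<close> and place this mass at the
  point \<open>x = 0.X\<close> of the interval \<open>[0, 1)\<close>. An integer whose digits are \<open>n\<^sub>1 n\<^sub>2\<close> followed by \<open>X\<close> is
  \<open>(n\<^sub>1 b + n\<^sub>2 + x) b\<^sup>l\<close>, so its reciprocal is the integrand \<open>1 / (n\<^sub>1 b + n\<^sub>2 + x)\<close> times the mass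
  of \<open>X\<close>. Hence the reciprocals of the integers with at least two digits sum to a finite combination
  of integrals
  \<open>\<integral> 1 / (N + x) d\<mu>(x)\<close> against the discrete measure \<open>\<mu>\<close> obtained from all admissible words
  (\<open>has_sum_avoiding\<close>). Expanding the kernel as a geometric series in \<open>x / N\<close>, which converges
  because \<open>N \<ge> 2\<close>, produces the alternating series in the moments of \<open>\<mu>\<close> (\<open>resolvent_sums\<close>).

  Everything else comes from one self-similarity (\<open>has_sum_first_letter\<close>): a nonempty admissible
  word is a digit followed by an admissible word, and the only words of this shape that have to be
  excluded are \<open>\<alpha>\<beta>Z\<close> with \<open>Z\<close> admissible; as \<open>\<alpha> \<noteq> \<beta>\<close>, the word \<open>\<beta>Z\<close> is
  admissible for each such \<open>Z\<close>. Applied to the weight, the identity shows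
  that \<open>\<mu>\<close> has finite mass \<open>b\<^sup>2\<close>; applied to the weighted powers of \<open>x\<close>, it gives the recursion that
  identifies the moments with the sequence \<open>u\<close>; applied twice to the reciprocals, it peels off the
  first two digits. The excluded words account for the negative terms of the formula.
\<close>

section \<open>Finite combinations of unordered sums\<close>

lemma has_sum_finite_sum:
  fixes f :: "'i \<Rightarrow> 'a \<Rightarrow> 'b :: topological_comm_monoid_add"
  assumes "\<And>i. i \<in> I \<Longrightarrow> (f i has_sum s i) A"
  shows "((\<lambda>x. \<Sum>i\<in>I. f i x) has_sum (\<Sum>i\<in>I. s i)) A"
  using assms by (induction I rule: infinite_finite_induct) (auto intro: has_sum_add)

lemma has_sum_difference:
  fixes f g :: "'a \<Rightarrow> real"
  assumes "(f has_sum s) A" "(g has_sum t) A"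
  shows "((\<lambda>x. f x - g x) has_sum (s - t)) A"
  using has_sum_add[OF assms(1) has_sum_cmult_right[OF assms(2), of "-1"]] by simp

section \<open>Admissible words and their first letter\<close>

locale forbidden_pair =
  fixes b \<alpha> \<beta> :: nat
  assumes b_gt_1: "b > 1" and \<alpha>_less: "\<alpha> < b" and \<beta>_less: "\<beta> < b" and \<alpha>_neq_\<beta>: "\<alpha> \<noteq> \<beta>"
begin

definition admissible_words :: "nat list set" where
  "admissible_words = {X. set X \<subseteq> {..<b} \<and> \<not> sublist [\<alpha>, \<beta>] X}"

definition weight :: "nat list \<Rightarrow> real" where
  "weight X = 1 / real b ^ length X"

text \<open>
  The number \<open>0.X\<close> in base \<open>b\<close>. Recursion on the leading digit makes its self-similarity definitional.
\<close>

fun frac_part :: "nat list \<Rightarrow> real" where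
  "frac_part [] = 0"
| "frac_part (d # X) = (real d + frac_part X) / real b"

lemma weight_Cons: "weight (d # X) = weight X / real b"
  by (simp add: weight_def)

lemma weight_Nil [simp]: "weight [] = 1"
  by (simp add: weight_def)

lemma weight_nonneg: "weight X \<ge> 0"
  by (simp add: weight_def)

lemma real_b_pos: "real b > 0"
  using b_gt_1 by simp

lemma Nil_admissible: "[] \<in> admissible_words"
  by (simp add: admissible_words_def)

lemma Cons_admissible_iff:
  "d # X \<in> admissible_words \<longleftrightarrow>
     d < b \<and> X \<in> admissible_words \<and> \<not> (d = \<alpha> \<and> (\<exists>Z. X = \<beta> # Z))"
  by (auto simp: admissible_words_def sublist_Cons_right prefix_def Cons_eq_append_conv)

lemma frac_part_bounds:
  assumes "X \<in> admissible_words"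
  shows "0 \<le> frac_part X" "frac_part X < 1"
proof -
  have "0 \<le> frac_part X \<and> frac_part X < 1"
    using assms
  proof (induction X)
    case (Cons d X)
    then have "d < b" and IH: "0 \<le> frac_part X" "frac_part X < 1"
      by (auto simp: Cons_admissible_iff)
    then have "real d + frac_part X < real b"
      by linarith
    with IH real_b_pos show ?case
      by simp
  qed simp
  then show "0 \<le> frac_part X" "frac_part X < 1" by auto
qed

text \<open>
  A word \<open>dY\<close> with \<open>Y\<close> admissible can fail to be admissible only at its first two letters. The set
  \<open>B\<close> of these failures consists of all \<open>\<alpha>\<beta>Z\<close> with \<open>Z\<close> admissible, since prepending \<open>\<beta> \<noteq> \<alpha>\<close>
  to \<open>Z\<close> creates no occurrence.
\<close>

lemma admissible_words_first_letter:
  "admissible_words =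
     insert [] (\<Union>d<b. (#) d ` admissible_words) - (\<lambda>X. \<alpha> # \<beta> # X) ` admissible_words"
  (is "_ = ?A - ?B")
proof (intro set_eqI)
  fix X
  show "X \<in> admissible_words \<longleftrightarrow> X \<in> ?A - ?B"
  proof (cases X)
    case Nil
    then show ?thesis by (auto simp: Nil_admissible)
  next
    case (Cons d Y)
    then show ?thesis
      using \<alpha>_neq_\<beta> by (cases Y) (auto simp: Cons_admissible_iff image_iff)
  qed
qed

text \<open>
  Summability over the admissible words is part of the conclusion and is inherited from the sums
  over the tails, so that sums over words can be built up starting from integrable functions of the
  tail.
\<close>

lemma has_sum_first_letter:
  fixes f :: "nat list \<Rightarrow> real"
  assumes "\<And>d. d < b \<Longrightarrow> ((\<lambda>X. f (d # X)) has_sum S d) admissible_words"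
    and "((\<lambda>X. f (\<alpha> # \<beta> # X)) has_sum T) admissible_words"
  shows "(f has_sum (f [] + (\<Sum>d<b. S d) - T)) admissible_words"
proof -
  have "(f has_sum (\<Sum>d<b. S d)) (\<Union>d<b. (#) d ` admissible_words)"
  proof (rule sum_has_sum)
    fix d assume "d \<in> {..<b}"
    then show "(f has_sum S d) ((#) d ` admissible_words)"
      using assms(1)[of d] by (subst has_sum_reindex) (auto simp: o_def)
  qed auto
  then have 1: "(f has_sum (f [] + (\<Sum>d<b. S d))) (insert [] (\<Union>d<b. (#) d ` admissible_words))"
    by (intro has_sum_insert) auto
  have 2: "(f has_sum T) ((\<lambda>X. \<alpha> # \<beta> # X) ` admissible_words)"
    using assms(2) by (subst has_sum_reindex) (auto simp: o_def inj_on_def)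
  have "(\<lambda>X. \<alpha> # \<beta> # X) ` admissible_words
      \<subseteq> insert [] (\<Union>d<b. (#) d ` admissible_words)"
    using \<alpha>_less \<beta>_less \<alpha>_neq_\<beta> by (auto simp: Cons_admissible_iff intro!: imageI bexI[of _ \<alpha>])
  from has_sum_Diff[OF 1 2 this] show ?thesis
    by (subst admissible_words_first_letter)
qed

section \<open>The total mass is finite\<close>

definition truncated_weight :: "nat \<Rightarrow> nat list \<Rightarrow> real" where
  "truncated_weight L X = (if length X \<le> L then weight X else 0)"

lemma truncated_weight_summable: "truncated_weight L summable_on admissible_words"
proof (rule finite_nonzero_values_imp_summable_on)
  have "{X \<in> admissible_words. truncated_weight L X \<noteq> 0} \<subseteq> {X. set X \<subseteq> {..<b} \<and> length X \<le> L}"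
    by (auto simp: admissible_words_def truncated_weight_def split: if_splits)
  then show "finite {X \<in> admissible_words. truncated_weight L X \<noteq> 0}"
    by (rule finite_subset) (rule finite_lists_length_le, simp)
qed

text \<open>
  The mass \<open>G L\<close> of the words of length at most \<open>L\<close> satisfies \<open>G (L + 2) = 1 + G (L + 1) - G L / b\<^sup>2\<close>
  by the decomposition at the first letter. Since \<open>G\<close> increases, the increment \<open>1 - G L / b\<^sup>2\<close> is
  nonnegative, which bounds \<open>G L\<close> without counting any words.
\<close>

lemma infsum_truncated_weight_le:
  "infsum (truncated_weight L) admissible_words \<le> real b ^ 2"
proof -
  define G where "G = (\<lambda>L. infsum (truncated_weight L) admissible_words)"
  have G: "(truncated_weight L has_sum G L) admissible_words" for L
    unfolding G_def using truncated_weight_summable by (rule has_sum_infsum)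
  have "(truncated_weight (L + 2) has_sum
      (truncated_weight (L + 2) [] + (\<Sum>d<b. G (L + 1) / real b) - G L / real b ^ 2)) admissible_words"
  proof (rule has_sum_first_letter)
    have "(\<lambda>X. truncated_weight (L + 2) (d # X)) = (\<lambda>X. truncated_weight (L + 1) X / real b)" for d
      by (auto simp: truncated_weight_def weight_Cons)
    then show "((\<lambda>X. truncated_weight (L + 2) (d # X)) has_sum G (L + 1) / real b) admissible_words" for d
      using has_sum_cmult_left[OF G, where c = "1 / real b"] by simp
    have "(\<lambda>X. truncated_weight (L + 2) (\<alpha> # \<beta> # X)) = (\<lambda>X. truncated_weight L X / real b ^ 2)"
      by (auto simp: truncated_weight_def weight_Cons power2_eq_square)
    then show "((\<lambda>X. truncated_weight (L + 2) (\<alpha> # \<beta> # X)) has_sum G L / real b ^ 2) admissible_words"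
      using has_sum_cmult_left[OF G, where c = "1 / real b ^ 2"] by simp
  qed
  from has_sum_unique[OF G this] have rec: "G (L + 2) = 1 + G (L + 1) - G L / real b ^ 2"
    using real_b_pos by (simp add: truncated_weight_def)
  have "G (L + 1) \<le> G (L + 2)"
    unfolding G_def
    by (intro infsum_mono truncated_weight_summable) (auto simp: truncated_weight_def weight_nonneg)
  with rec have "G L / real b ^ 2 \<le> 1"
    by simp
  then show ?thesis
    using real_b_pos by (simp add: G_def field_simps)
qed

lemma weight_summable: "weight summable_on admissible_words"
proof (rule nonneg_bounded_partial_sums_imp_summable_on)
  show "\<forall>\<^sub>F F in finite_subsets_at_top admissible_words. sum weight F \<le> real b ^ 2"
  proof (rule eventually_finite_subsets_at_top_weakI)
    fix F assume F: "finite F" "F \<subseteq> admissible_words"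
    define L where "L = Max (length ` F)"
    have "sum weight F = sum (truncated_weight L) F"
      using F by (intro sum.cong) (auto simp: truncated_weight_def L_def)
    also have "\<dots> \<le> infsum (truncated_weight L) admissible_words"
      using F by (intro finite_sum_le_infsum truncated_weight_summable)
        (auto simp: truncated_weight_def weight_nonneg)
    also have "\<dots> \<le> real b ^ 2"
      by (rule infsum_truncated_weight_le)
    finally show "sum weight F \<le> real b ^ 2" .
  qed
qed (rule weight_nonneg)

section \<open>The moments and their recursion\<close>

definition moment :: "nat \<Rightarrow> real" where
  "moment m = (\<Sum>\<^sub>\<infinity>X\<in>admissible_words. weight X * frac_part X ^ m)"

lemma has_sum_moment:
  "((\<lambda>X. weight X * frac_part X ^ m) has_sum moment m) admissible_words"
  unfolding moment_def
proof (rule has_sum_infsum, rule summable_on_comparison_test[OF weight_summable])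
  fix X assume "X \<in> admissible_words"
  note frac_part_bounds[OF this]
  then show "weight X * frac_part X ^ m \<le> weight X" "0 \<le> weight X * frac_part X ^ m"
    using weight_nonneg[of X] by (auto intro!: mult_left_le power_le_one)
qed

lemma has_sum_shifted_moment:
  "((\<lambda>X. weight X * (c + frac_part X) ^ m) has_sum
     (\<Sum>j\<le>m. real (m choose j) * c ^ j * moment (m - j))) admissible_words"
proof -
  have "((\<lambda>X. \<Sum>j\<le>m. real (m choose j) * c ^ j * (weight X * frac_part X ^ (m - j))) has_sum
     (\<Sum>j\<le>m. real (m choose j) * c ^ j * moment (m - j))) admissible_words"
    by (intro has_sum_finite_sum has_sum_cmult_right has_sum_moment)
  then show ?thesis
    by (simp add: binomial_ring sum_distrib_left mult_ac)
qed

text \<open>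
  Prepending \<open>d\<close> turns \<open>x\<close> into \<open>(d + x) / b\<close> and divides the weight by \<open>b\<close>; prepending \<open>\<alpha>\<beta>\<close> turns
  \<open>x\<close> into \<open>(\<alpha> b + \<beta> + x) / b\<^sup>2\<close> and divides the weight by \<open>b\<^sup>2\<close>. This explains the denominators.
\<close>

lemma moment_first_letter:
  "moment m = 0 ^ m
     + (\<Sum>d<b. (\<Sum>j\<le>m. real (m choose j) * real d ^ j * moment (m - j)) / real b ^ (m + 1))
     - (\<Sum>j\<le>m. real (m choose j) * real (\<alpha> * b + \<beta>) ^ j * moment (m - j)) / real b ^ (2 * (m + 1))"
proof -
  let ?f = "\<lambda>X. weight X * frac_part X ^ m"
  have "(?f has_sum ?f []
     + (\<Sum>d<b. (\<Sum>j\<le>m. real (m choose j) * real d ^ j * moment (m - j)) / real b ^ (m + 1))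
     - (\<Sum>j\<le>m. real (m choose j) * real (\<alpha> * b + \<beta>) ^ j * moment (m - j)) / real b ^ (2 * (m + 1)))
     admissible_words"
  proof (rule has_sum_first_letter)
    fix d
    have "(\<lambda>X. ?f (d # X)) = (\<lambda>X. weight X * (real d + frac_part X) ^ m * (1 / real b ^ (m + 1)))"
      by (auto simp: weight_Cons power_divide)
    then show "((\<lambda>X. ?f (d # X)) has_sum
        (\<Sum>j\<le>m. real (m choose j) * real d ^ j * moment (m - j)) / real b ^ (m + 1)) admissible_words"
      using has_sum_cmult_left[OF has_sum_shifted_moment[of "real d" m], where c = "1 / real b ^ (m + 1)"]
      by simp
  next
    have "frac_part (\<alpha> # \<beta> # X) = (real (\<alpha> * b + \<beta>) + frac_part X) / real b ^ 2" for X
      using real_b_pos by (simp add: field_simps power2_eq_square)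
    then have "(\<lambda>X. ?f (\<alpha> # \<beta> # X)) =
        (\<lambda>X. weight X * (real (\<alpha> * b + \<beta>) + frac_part X) ^ m * (1 / real b ^ (2 * (m + 1))))"
      by (auto simp del: frac_part.simps
            simp: weight_Cons power_divide power2_eq_square power_add power_mult_distrib mult_2)
    then show "((\<lambda>X. ?f (\<alpha> # \<beta> # X)) has_sum
        (\<Sum>j\<le>m. real (m choose j) * real (\<alpha> * b + \<beta>) ^ j * moment (m - j)) / real b ^ (2 * (m + 1)))
        admissible_words"
      using has_sum_cmult_left[OF has_sum_shifted_moment[of "real (\<alpha> * b + \<beta>)" m], where c = "1 / real b ^ (2 * (m + 1))"]
      by simp
  qed
  from has_sum_unique[OF has_sum_moment this] show ?thesis
    by (simp add: power_0_left)
qed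

lemma moment_0: "moment 0 = real b ^ 2"
  using moment_first_letter[of 0] real_b_pos by (simp add: field_simps power2_eq_square)

text \<open>
  Multiply the previous identity by \<open>b^(m + 1)\<close>: the terms with \<open>j = 0\<close> contain the moment of order \<open>m\<close>
  itself and move to the left-hand side.
\<close>

lemma moment_recursion:
  assumes "m \<ge> 1"
  shows "(real b ^ (m + 1) - real b + 1 / real b ^ (m + 1)) * moment m =
      (\<Sum>j = 1..m. real (m choose j) *
         (digit_power_sum b j - 1 / real b ^ (m + 1) * real (\<alpha> * b + \<beta>) ^ j) * moment (m - j))"
proof -
  let ?B = "real b ^ (m + 1)"
  define g where "g j = real (m choose j) *
         (digit_power_sum b j - 1 / ?B * real (\<alpha> * b + \<beta>) ^ j) * moment (m - j)" for j
  have "(\<Sum>d<b. \<Sum>j\<le>m. real (m choose j) * real d ^ j * moment (m - j)) =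
      (\<Sum>j\<le>m. real (m choose j) * digit_power_sum b j * moment (m - j))"
    unfolding digit_power_sum_def by (subst sum.swap) (simp add: sum_distrib_left sum_distrib_right)
  then have "(\<Sum>j\<le>m. g j) =
      (\<Sum>d<b. \<Sum>j\<le>m. real (m choose j) * real d ^ j * moment (m - j))
      - (\<Sum>j\<le>m. real (m choose j) * real (\<alpha> * b + \<beta>) ^ j * moment (m - j)) / ?B"
    by (simp add: g_def sum_subtractf sum_divide_distrib algebra_simps)
  also have "\<dots> = ?B * moment m"
  proof -
    have "?B \<noteq> 0" using real_b_pos by simp
    moreover have "real b ^ (2 * (m + 1)) = ?B * ?B"
      by (simp only: mult_2 power_add)
    moreover have "(0::real) ^ m = 0" using assms by simp
    ultimately show ?thesis
      by (subst moment_first_letter[of m])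
         (simp only: sum_divide_distrib[symmetric], simp add: field_simps)
  qed
  finally have "?B * moment m = g 0 + (\<Sum>j = 1..m. g j)"
    by (simp add: sum.atMost_shift sum.atLeast1_atMost_eq lessThan_Suc_atMost)
  moreover have "g 0 = (real b - 1 / ?B) * moment m"
    by (simp add: g_def digit_power_sum_def)
  ultimately have "(?B - real b + 1 / ?B) * moment m = (\<Sum>j = 1..m. g j)"
    by (simp add: algebra_simps)
  then show ?thesis
    by (simp only: g_def)
qed

text \<open>
  The coefficient of \<open>u m\<close> is positive because \<open>b^(m + 1) \<ge> b\<close>, so the recursion determines its solution.
\<close>

lemma moment_unique:
  assumes "u 0 = real b ^ 2"
    and "\<And>m. m \<ge> 1 \<Longrightarrow>
      (real b ^ (m + 1) - real b + 1 / real b ^ (m + 1)) * u m =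
      (\<Sum>j = 1..m. real (m choose j) *
         (digit_power_sum b j - 1 / real b ^ (m + 1) * real (\<alpha> * b + \<beta>) ^ j) * u (m - j))"
  shows "u m = moment m"
proof (induction m rule: less_induct)
  case (less m)
  show ?case
  proof (cases "m = 0")
    case True
    then show ?thesis by (simp add: assms(1) moment_0)
  next
    case False
    have "real b \<le> real b ^ (m + 1)"
      using b_gt_1 power_increasing[of 1 "m + 1" "real b"] by simp
    moreover have "1 / real b ^ (m + 1) > 0"
      using real_b_pos by simp
    ultimately have "real b ^ (m + 1) - real b + 1 / real b ^ (m + 1) \<noteq> 0"
      by linarith
    moreover have "(real b ^ (m + 1) - real b + 1 / real b ^ (m + 1)) * u m =
        (real b ^ (m + 1) - real b + 1 / real b ^ (m + 1)) * moment m"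
      using False less.IH
      by (subst assms(2), simp, subst moment_recursion, simp) (intro sum.cong, auto)
    ultimately show ?thesis by simp
  qed
qed

section \<open>The integrals of \<open>1 / (N + x)\<close>\<close>

definition resolvent :: "nat \<Rightarrow> real" where
  "resolvent N = (\<Sum>\<^sub>\<infinity>X\<in>admissible_words. weight X / (real N + frac_part X))"

lemma has_sum_resolvent:
  assumes "N \<ge> 1"
  shows "((\<lambda>X. weight X / (real N + frac_part X)) has_sum resolvent N) admissible_words"
  unfolding resolvent_def
proof (rule has_sum_infsum, rule summable_on_comparison_test[OF weight_summable])
  fix X assume "X \<in> admissible_words"
  note frac_part_bounds[OF this]
  then have "1 \<le> real N + frac_part X"
    using assms by linarith
  then show "weight X / (real N + frac_part X) \<le> weight X" "0 \<le> weight X / (real N + frac_part X)"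
    using weight_nonneg[of X] divide_left_mono[of 1 "real N + frac_part X" "weight X"] by auto
qed

text \<open>
  Truncating the geometric series of \<open>1 / (N + x)\<close> after \<open>M\<close> terms leaves the remainder
  \<open>(-x / N)\<^sup>M / (N + x)\<close>, which is at most \<open>N^(-M)\<close> in absolute value uniformly in \<open>x\<close>.
  Integrating this bound replaces an interchange of two infinite sums.
\<close>

lemma resolvent_sums:
  assumes "N \<ge> 2"
  shows "(\<lambda>m. (-1) ^ m * moment m * (1 / real N ^ (m + 1))) sums resolvent N"
proof -
  define P where "P M = (\<Sum>m<M. (-1) ^ m * moment m * (1 / real N ^ (m + 1)))" for M
  have bound: "norm (resolvent N - P M) \<le> moment 0 * (1 / real N) ^ M" for M
  proof -
    have P: "((\<lambda>X. \<Sum>m<M. (-1) ^ m * (1 / real N ^ (m + 1)) * (weight X * frac_part X ^ m)) has_sum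
        (\<Sum>m<M. (-1) ^ m * (1 / real N ^ (m + 1)) * moment m)) admissible_words"
      by (intro has_sum_finite_sum has_sum_cmult_right has_sum_moment)
    have "((\<lambda>X. weight X / (real N + frac_part X)
          - (\<Sum>m<M. (-1) ^ m * (1 / real N ^ (m + 1)) * (weight X * frac_part X ^ m))) has_sum
        (resolvent N - P M)) admissible_words"
      using has_sum_difference[OF has_sum_resolvent P] assms by (simp add: P_def mult_ac)
    moreover have "weight X / (real N + frac_part X)
          - (\<Sum>m<M. (-1) ^ m * (1 / real N ^ (m + 1)) * (weight X * frac_part X ^ m))
        = weight X * (- frac_part X / real N) ^ M / (real N + frac_part X)" 
      if "X \<in> admissible_words" for X
    proof -
      define r where "r = - frac_part X / real N"
      have x: "0 \<le> frac_part X" "frac_part X < 1"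
        using frac_part_bounds[OF that] by auto
      have r1: "r \<noteq> 1" and r2: "real N * (1 - r) = real N + frac_part X"
        using x assms by (auto simp: r_def field_simps)
      have "(\<Sum>m<M. (-1) ^ m * (1 / real N ^ (m + 1)) * (weight X * frac_part X ^ m))
          = weight X / real N * (\<Sum>m<M. r ^ m)"
        unfolding sum_distrib_left
        by (intro sum.cong refl)
           (simp add: r_def power_divide power_minus[of "frac_part X / real N"] mult_ac)
      also have "\<dots> = weight X * (1 - r ^ M) / (real N * (1 - r))"
        using r1 by (subst sum_gp_strict) auto
      finally show ?thesis
        unfolding r2 by (simp add: r_def diff_divide_distrib algebra_simps)
    qed
    ultimately have "((\<lambda>X. weight X * (- frac_part X / real N) ^ M / (real N + frac_part X)) has_sum
        (resolvent N - P M)) admissible_words"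
      by (simp cong: has_sum_cong)
    moreover have "((\<lambda>X. weight X * frac_part X ^ 0 * (1 / real N) ^ M) has_sum
        moment 0 * (1 / real N) ^ M) admissible_words"
      by (intro has_sum_cmult_left has_sum_moment)
    moreover have "norm (weight X * (- frac_part X / real N) ^ M / (real N + frac_part X))
        \<le> weight X * frac_part X ^ 0 * (1 / real N) ^ M" if "X \<in> admissible_words" for X
    proof -
      have x: "0 \<le> frac_part X" "frac_part X < 1"
        using frac_part_bounds[OF that] by auto
      have "norm (weight X * (- frac_part X / real N) ^ M / (real N + frac_part X))
          = weight X * (frac_part X / real N) ^ M / (real N + frac_part X)"
        using x weight_nonneg[of X] by (simp add: abs_mult power_abs)
      also have "\<dots> \<le> weight X * (frac_part X / real N) ^ M / 1"
        using x assms weight_nonneg[of X] by (intro divide_left_mono) auto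
      also have "\<dots> \<le> weight X * (1 / real N) ^ M"
        using x weight_nonneg[of X]
        by (simp, intro mult_left_mono power_mono divide_right_mono) auto
      finally show ?thesis by simp
    qed
    ultimately show ?thesis
      by (rule norm_infsum_le)
  qed
  have "(\<lambda>M. moment 0 * (1 / real N) ^ M) \<longlonglongrightarrow> moment 0 * 0"
    using assms by (intro tendsto_mult_left LIMSEQ_realpow_zero) auto
  then have "(\<lambda>M. moment 0 * (1 / real N) ^ M) \<longlonglongrightarrow> 0"
    by simp
  then have "(\<lambda>M. resolvent N - P M) \<longlonglongrightarrow> 0"
    by (rule Lim_null_comparison[rotated]) (intro always_eventually allI bound)
  from tendsto_diff[OF tendsto_const[of "resolvent N"] this] have "P \<longlonglongrightarrow> resolvent N"
    by simp
  then show ?thesis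
    unfolding sums_def P_def[symmetric] .
qed

section \<open>Integers as words without leading zero\<close>

abbreviation word_value :: "nat list \<Rightarrow> nat" where
  "word_value X \<equiv> horner_sum id b (rev X)"

lemma word_value_Cons: "word_value (d # X) = d * b ^ length X + word_value X"
  by (simp add: horner_sum_append)

lemma word_value_frac_part: "real (word_value X) = real b ^ length X * frac_part X"
  using real_b_pos
  by (induction X) (simp_all add: word_value_Cons del: rev.simps(2), simp add: field_simps)

lemma bij_betw_word_value:
  "bij_betw word_value {X \<in> admissible_words. X \<noteq> [] \<and> hd X \<noteq> 0} (avoiding b \<alpha> \<beta>)"
proof (rule bij_betw_byWitness[where f' = "base_digits b"])
  show "\<forall>X\<in>{X \<in> admissible_words. X \<noteq> [] \<and> hd X \<noteq> 0}. base_digits b (word_value X) = X"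
    using b_gt_1 by (auto simp: admissible_words_def intro!: base_digits_unique)
  then show "word_value ` {X \<in> admissible_words. X \<noteq> [] \<and> hd X \<noteq> 0} \<subseteq> avoiding b \<alpha> \<beta>"
    by (force simp: avoiding_def admissible_words_def intro!: gr0I)
  show "\<forall>n\<in>avoiding b \<alpha> \<beta>. word_value (base_digits b n) = n"
    using b_gt_1 by (simp add: horner_sum_base_digits)
  show "base_digits b ` avoiding b \<alpha> \<beta> \<subseteq> {X \<in> admissible_words. X \<noteq> [] \<and> hd X \<noteq> 0}"
    using b_gt_1 set_base_digits[OF b_gt_1] hd_base_digits[OF b_gt_1]
    by (auto simp: avoiding_def admissible_words_def base_digits_eq_Nil_iff)
qed

text \<open>
  Split off the first letter of the word of \<open>n\<close>, then the second one. The first step subtracts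
  the words \<open>\<alpha>\<beta>Z\<close>, which removes the pair \<open>(\<alpha>, \<beta>)\<close> from the double sum; the second step subtracts
  the words \<open>n\<^sub>1\<alpha>\<beta>Z\<close>, which gives the last sum.
\<close>

lemma has_sum_avoiding:
  "((\<lambda>n. 1 / real n) has_sum
     ((\<Sum>n\<^sub>1 = 1..<b. 1 / real n\<^sub>1)
      + ((\<Sum>(n\<^sub>1, n\<^sub>2) \<in> {1..<b} \<times> {0..<b} - {(\<alpha>, \<beta>)}. resolvent (n\<^sub>1 * b + n\<^sub>2))
         - (\<Sum>n\<^sub>1 = 1..<b. resolvent (n\<^sub>1 * b^2 + \<alpha> * b + \<beta>)))))
   (avoiding b \<alpha> \<beta>)"
proof -
  \<comment> \<open>Extending the reciprocal by \<open>0\<close> to words with a leading zero lets \<open>f\<close> be summed over all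
    admissible words.\<close>
  define f where "f X = (if X \<noteq> [] \<and> hd X \<noteq> 0 then 1 / real (word_value X) else 0)" for X
  have "real (word_value (d # e # X)) = real b ^ length X * (real (d * b + e) + frac_part X)" for d e X
    using real_b_pos
    by (simp only: word_value_frac_part) (simp add: field_simps)
  then have f_pair: "f (d # e # X) = weight X / (real (d * b + e) + frac_part X)" if "d > 0" for d e X
    using that by (simp add: f_def weight_def del: rev.simps)
  have "real (word_value (d # \<alpha> # \<beta> # X)) =
      real b ^ length X * (real (d * b ^ 2 + \<alpha> * b + \<beta>) + frac_part X)" for d X
    using real_b_pos
    by (simp only: word_value_frac_part) (simp add: field_simps power2_eq_square)
  then have f_triple: "f (d # \<alpha> # \<beta> # X) = weight X / (real (d * b ^ 2 + \<alpha> * b + \<beta>) + frac_part X)"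
    if "d > 0" for d X
    using that by (simp add: f_def weight_def del: rev.simps)
  define S where "S d = (if d = 0 then 0 else
     1 / real d + (\<Sum>e<b. resolvent (d * b + e)) - resolvent (d * b ^ 2 + \<alpha> * b + \<beta>))" for d
  \<comment> \<open>For \<open>\<alpha> = 0\<close> the word \<open>\<alpha>\<beta>Z\<close> has a leading zero; correspondingly, the pair \<open>(\<alpha>, \<beta>)\<close> then does
    not lie in the index set of the double sum.\<close>
  define T where "T = (if \<alpha> = 0 then 0 else resolvent (\<alpha> * b + \<beta>))"
  have "(f has_sum (f [] + (\<Sum>d<b. S d) - T)) admissible_words"
  proof (rule has_sum_first_letter)
    show "((\<lambda>X. f (d # X)) has_sum S d) admissible_words" for d
    proof (cases "d = 0")
      case True
      then show ?thesis by (simp add: f_def S_def)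
    next
      case False
      have "((\<lambda>X. f (d # X)) has_sum
          (f [d] + (\<Sum>e<b. resolvent (d * b + e)) - resolvent (d * b ^ 2 + \<alpha> * b + \<beta>))) admissible_words"
      proof (rule has_sum_first_letter)
        have "d * b > 0"
          using False b_gt_1 by simp
        then have ge: "d * b + e \<ge> 1" "d * b ^ 2 + \<alpha> * b + \<beta> \<ge> 1" for e
          using b_gt_1 by (auto simp: power2_eq_square Suc_le_eq)
        show "((\<lambda>X. f (d # e # X)) has_sum resolvent (d * b + e)) admissible_words" for e
          using has_sum_resolvent[OF ge(1)] False by (simp only: f_pair neq0_conv)
        show "((\<lambda>X. f (d # \<alpha> # \<beta> # X)) has_sum resolvent (d * b ^ 2 + \<alpha> * b + \<beta>)) admissible_words"
          using has_sum_resolvent[OF ge(2)] False by (simp only: f_triple neq0_conv)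
      qed
      then show ?thesis
        using False by (simp add: S_def f_def)
    qed
    show "((\<lambda>X. f (\<alpha> # \<beta> # X)) has_sum T) admissible_words"
    proof (cases "\<alpha> = 0")
      case True
      then show ?thesis by (simp add: f_def T_def)
    next
      case False
      then show ?thesis
        using b_gt_1 by (simp add: f_pair T_def has_sum_resolvent Suc_le_eq del: of_nat_add of_nat_mult)
    qed
  qed
  moreover have "f [] + (\<Sum>d<b. S d) - T =
     (\<Sum>n\<^sub>1 = 1..<b. 1 / real n\<^sub>1)
      + ((\<Sum>(n\<^sub>1, n\<^sub>2) \<in> {1..<b} \<times> {0..<b} - {(\<alpha>, \<beta>)}. resolvent (n\<^sub>1 * b + n\<^sub>2))
         - (\<Sum>n\<^sub>1 = 1..<b. resolvent (n\<^sub>1 * b^2 + \<alpha> * b + \<beta>)))"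
  proof -
    have "(\<Sum>d<b. S d) = (\<Sum>d = 1..<b. S d)"
      by (intro sum.mono_neutral_right) (auto simp: S_def Suc_le_eq)
    also have "\<dots> = (\<Sum>d = 1..<b. 1 / real d + (\<Sum>e<b. resolvent (d * b + e))
        - resolvent (d * b ^ 2 + \<alpha> * b + \<beta>))"
      by (intro sum.cong) (auto simp: S_def)
    also have "\<dots> = (\<Sum>d = 1..<b. 1 / real d) + (\<Sum>d = 1..<b. \<Sum>e = 0..<b. resolvent (d * b + e))
        - (\<Sum>d = 1..<b. resolvent (d * b ^ 2 + \<alpha> * b + \<beta>))"
      by (simp add: sum.distrib sum_subtractf lessThan_atLeast0)
    also have "(\<Sum>d = 1..<b. \<Sum>e = 0..<b. resolvent (d * b + e)) =
        (\<Sum>(n\<^sub>1, n\<^sub>2) \<in> {1..<b} \<times> {0..<b}. resolvent (n\<^sub>1 * b + n\<^sub>2))"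
      by (rule sum.cartesian_product)
    also have "\<dots> = (\<Sum>(n\<^sub>1, n\<^sub>2) \<in> {1..<b} \<times> {0..<b} - {(\<alpha>, \<beta>)}. resolvent (n\<^sub>1 * b + n\<^sub>2)) + T"
      using \<alpha>_less \<beta>_less by (subst sum_diff1) (auto simp: T_def)
    finally show ?thesis
      by (simp add: f_def)
  qed
  ultimately have "(f has_sum
     (\<Sum>n\<^sub>1 = 1..<b. 1 / real n\<^sub>1)
      + ((\<Sum>(n\<^sub>1, n\<^sub>2) \<in> {1..<b} \<times> {0..<b} - {(\<alpha>, \<beta>)}. resolvent (n\<^sub>1 * b + n\<^sub>2))
         - (\<Sum>n\<^sub>1 = 1..<b. resolvent (n\<^sub>1 * b^2 + \<alpha> * b + \<beta>)))) admissible_words"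
    by simp
  then have "((\<lambda>X. 1 / real (word_value X)) has_sum
     (\<Sum>n\<^sub>1 = 1..<b. 1 / real n\<^sub>1)
      + ((\<Sum>(n\<^sub>1, n\<^sub>2) \<in> {1..<b} \<times> {0..<b} - {(\<alpha>, \<beta>)}. resolvent (n\<^sub>1 * b + n\<^sub>2))
         - (\<Sum>n\<^sub>1 = 1..<b. resolvent (n\<^sub>1 * b^2 + \<alpha> * b + \<beta>))))
     {X \<in> admissible_words. X \<noteq> [] \<and> hd X \<noteq> 0}"
    by (rule has_sum_cong_neutral[THEN iffD1, rotated -1]) (auto simp: f_def)
  then show ?thesis
    by (subst (asm) has_sum_reindex_bij_betw[OF bij_betw_word_value])
qed

section \<open>The series\<close>

lemma resolvent_combination_sums:
  "(\<lambda>m. (-1) ^ m * moment m * inverse_power_diff b \<alpha> \<beta> (m + 1)) sums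
     ((\<Sum>(n\<^sub>1, n\<^sub>2) \<in> {1..<b} \<times> {0..<b} - {(\<alpha>, \<beta>)}. resolvent (n\<^sub>1 * b + n\<^sub>2))
         - (\<Sum>n\<^sub>1 = 1..<b. resolvent (n\<^sub>1 * b^2 + \<alpha> * b + \<beta>)))"
proof -
  \<comment> \<open>The integrands with two-digit \<open>N\<close> have \<open>N \<ge> b \<ge> 2\<close>, the bound for termwise integration; this is
    why two leading digits are peeled off and not just one.\<close>
  have 1: "n\<^sub>1 * b + n\<^sub>2 \<ge> 2" "n\<^sub>1 * b ^ 2 + \<alpha> * b + \<beta> \<ge> 2" if "n\<^sub>1 \<ge> 1" for n\<^sub>1 n\<^sub>2
  proof -
    have "1 * 2 \<le> n\<^sub>1 * b" "n\<^sub>1 * b * 1 \<le> n\<^sub>1 * b * b"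
      using that b_gt_1 by (intro mult_le_mono; simp)+
    then have "2 \<le> n\<^sub>1 * b" "2 \<le> n\<^sub>1 * b * b"
      by linarith+
    then show "n\<^sub>1 * b + n\<^sub>2 \<ge> 2" "n\<^sub>1 * b ^ 2 + \<alpha> * b + \<beta> \<ge> 2"
      by (simp_all add: power2_eq_square mult.assoc)
  qed
  have "(\<lambda>m. (\<Sum>p \<in> {1..<b} \<times> {0..<b} - {(\<alpha>, \<beta>)}.
           (-1) ^ m * moment m * (1 / real (fst p * b + snd p) ^ (m + 1)))
         - (\<Sum>n\<^sub>1 = 1..<b. (-1) ^ m * moment m * (1 / real (n\<^sub>1 * b ^ 2 + \<alpha> * b + \<beta>) ^ (m + 1)))) sums
     ((\<Sum>p \<in> {1..<b} \<times> {0..<b} - {(\<alpha>, \<beta>)}. resolvent (fst p * b + snd p))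
         - (\<Sum>n\<^sub>1 = 1..<b. resolvent (n\<^sub>1 * b^2 + \<alpha> * b + \<beta>)))"
    by (intro sums_diff sums_sum resolvent_sums 1) auto
  then show ?thesis
    unfolding inverse_power_diff_def right_diff_distrib sum_distrib_left by (simp add: case_prod_beta)
qed

end

theorem theorem13:
  fixes b \<alpha> \<beta> :: nat and u :: "nat \<Rightarrow> real"
  assumes "b > 1" and "\<alpha> < b" and "\<beta> < b" and "\<alpha> \<noteq> \<beta>"
    and "u 0 = real b ^ 2"
    and "\<And>m. m \<ge> 1 \<Longrightarrow>
      (real b ^ (m + 1) - real b + 1 / real b ^ (m + 1)) * u m =
      (\<Sum>j = 1..m. real (m choose j) *
         (digit_power_sum b j - 1 / real b ^ (m + 1) * real (\<alpha> * b + \<beta>) ^ j) * u (m - j))"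
  shows "(\<lambda>n. 1 / real n) summable_on avoiding b \<alpha> \<beta>
    \<and> summable (\<lambda>i. (-1) ^ (Suc i) * u (Suc i) * inverse_power_diff b \<alpha> \<beta> (Suc i + 1))
    \<and> kempner_sum b \<alpha> \<beta> =
      (\<Sum>n\<^sub>1 = 1..<b. 1 / real n\<^sub>1)
      + real b ^ 2 * inverse_power_diff b \<alpha> \<beta> 1
      + (\<Sum>i. (-1) ^ (Suc i) * u (Suc i) * inverse_power_diff b \<alpha> \<beta> (Suc i + 1))"
proof -
  interpret forbidden_pair b \<alpha> \<beta>
    using assms(1-4) by unfold_locales
  have u: "moment = u"
    using moment_unique[OF assms(5,6)] by (intro ext) simp
  define a where "a m = (-1) ^ m * u m * inverse_power_diff b \<alpha> \<beta> (m + 1)" for m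
  have sums: "a sums ((\<Sum>(n\<^sub>1, n\<^sub>2) \<in> {1..<b} \<times> {0..<b} - {(\<alpha>, \<beta>)}. resolvent (n\<^sub>1 * b + n\<^sub>2))
         - (\<Sum>n\<^sub>1 = 1..<b. resolvent (n\<^sub>1 * b^2 + \<alpha> * b + \<beta>)))"
    using resolvent_combination_sums unfolding u a_def .
  then have summable: "summable a"
    by (rule sums_summable)
  have "kempner_sum b \<alpha> \<beta> = (\<Sum>n\<^sub>1 = 1..<b. 1 / real n\<^sub>1) + suminf a"
    unfolding kempner_sum_def using infsumI[OF has_sum_avoiding] sums_unique[OF sums] by simp
  also have "suminf a = a 0 + (\<Sum>i. a (Suc i))"
    using suminf_split_head[OF summable] by simp
  also have "a 0 = real b ^ 2 * inverse_power_diff b \<alpha> \<beta> 1"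
    by (simp add: a_def assms(5))
  finally have "kempner_sum b \<alpha> \<beta> = (\<Sum>n\<^sub>1 = 1..<b. 1 / real n\<^sub>1)
      + real b ^ 2 * inverse_power_diff b \<alpha> \<beta> 1 + (\<Sum>i. a (Suc i))"
    by simp
  moreover have "summable (\<lambda>i. a (Suc i))"
    using summable by (simp add: summable_Suc_iff)
  moreover have "(\<lambda>n. 1 / real n) summable_on avoiding b \<alpha> \<beta>"
    using has_sum_avoiding by (rule has_sum_imp_summable)
  ultimately show ?thesis
    unfolding a_def by blast
qed

end
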